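(* Let $\alpha,\delta\in(0,1)$, $s\in(0,1]$, $\lambda\in[0,1)$ with $\lambda\ge s$, and consider the sequence of generalized VCT models $(\mathbf P^{(m)}_{\pi,\beta,F_0,F_1},m\ge1)$. Assume: (i) $\Pi:[0,\infty)\to\mathbb R_+$ is continuous, decreasing and $L$-Lipschitz; (ii) $F_0(s)=s$, $F_0(\lambda)=\lambda$, $F_1(s)>s$, $F_1(\lambda)>\lambda$; (iii) $\alpha>\underline\alpha$, where $$\underline\alpha=\frac{1+\pi(0)\bigl(\frac{1-F_1(\lambda)}{1-\lambda}-1\bigr)}{1+\pi(0)\bigl(\frac{F_1(s)}{s}-1\bigr)}.$$ Let $\hat k_\alpha,\hat r_\alpha$ be associated with the Lei–Fithian (LF) procedure with parameters $s,\lambda$ at level $\alpha$. Then the consistency property $$\forall\epsilon>0,\quad\lim_{m\to\infty}\mathbf P^{(m)}_{\pi,\beta,F_0,F_1}\bigl(\overline{\mathrm{FDP}}-\alpha\ge\epsilon\bigr)=0$$ holds in either of the two following cases: - KR-U: for $\overline{\mathrm{FDP}}=\overline{\mathrm{FDP}}^{\text{KR-U}}_{\hat k_\alpha}$, the value at $k=\hat k_\alpha$ of the KR-U envelope $$\overline{\mathrm{FDP}}^{\text{KR-U}}_k=1\wedge\min_{a\in\mathbb N\setminus\{0\}}\left\{\frac{\log(1/\delta_a)}{a\log(1+\frac{1-\delta_a^{B/a}}{B})}\,\frac{a+\frac s{1-\lambda}\sum_{i=1}^k\mathbf 1\{p_i>\lambda\}}{1\vee\sum_{i=1}^k\mathbf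 1\{p_i\le s\}}\right\},\quad k\ge1,$$ and for the corresponding bound $$\overline{\mathrm{FDP}}=1\wedge\min_{1\le a\le1\vee\hat r_\alpha}\left\{\frac{\log(1/\delta_a)}{a\log(1+\frac{1-\delta_a^{B/a}}{B})}\Bigl(\alpha+\frac a{1\vee\hat r_\alpha}\Bigr)\right\}$$ (minimum over integers $a$); - Freedman, if either $\lambda=s$ or $\beta<1/2$: for $\overline{\mathrm{FDP}}=\overline{\mathrm{FDP}}^{\text{Freed}}_{\hat k_\alpha}$, the value at $k=\hat k_\alpha$ of the Freedman envelope $$\overline{\mathrm{FDP}}^{\text{Freed}}_k=1\wedge\frac{\frac s{1-\lambda}\sum_{i=1}^k\mathbf 1\{p_i>\lambda\}+\Delta(\nu k)}{\sum_{i=1}^k\mathbf 1\{p_i\le s\}},\quad k\ge1,$$ and for the corresponding bound $\overline{\mathrm{FDP}}=1\wedge\bigl(\alpha+\Delta(\nu\hat k_\alpha)/(1\vee\hat r_\alpha)\bigr)$.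
   Context: Generalized VCT (varying coefficient two-groups) model $\mathbf P^{(m)}_{\pi,\beta,F_0,F_1}$: $\beta\in[0,1)$, $F_0,F_1$ are c.d.f.s on $[0,1]$ with $F_0(t)\le t$ for all $t\in[0,1]$, and $\pi:[0,\infty)\to[0,1)$ is a measurable function with $\pi(0)>0$ and $\pi(x)=\pi(1)$ for $x\ge1$. The pairs $(p_k,H_k)\in[0,1]\times\{0,1\}$, $1\le k\le m$, are independent, with $\mathbf P(H_k=1)=\pi(m^\beta k/m)$ and $p_k\mid\{H_k=i\}\sim F_i$, $i\in\{0,1\}$ ($H_k=0$ meaning a true null). $\Pi(t)=t^{-1}\int_0^t\pi(u)\,du$ for $t>0$, $\Pi(0)=\pi(0)$. All parameters other than $m$ are fixed as $m\to\infty$. LF procedure (identity ordering): $\hat k_\alpha=\max\{k\in\{0,\dots,m\}:\widehat{\mathrm{FDP}}_k\le\alpha\}$ ($0$ if the set is empty), $\widehat{\mathrm{FDP}}_k=\frac{s}{1-\lambda}\frac{1+\sum_{i=1}^k\mathbf 1\{p_i>\lambda\}}{1\vee\sum_{i=1}^k\mathbf 1\{p_i\le s\}}$, and $\hat r_\alpha=\sum_{i=1}^{\hat k_\alpha}\mathbf 1\{p_i\le s\}$ is its number of rejections. Envelopes are set to $0$ at $k=0$, and a positive number divided by $0$ is read as $+\infty$. Notation: $\kappa=\pi_\circ^2/6$ with $\pi_\circ=3.14159\ldots$; $\delta_a=\delta/(\kappa a^2)$; $B=s/(1-\lambda)$; $\nu=s(1+s/(1-\lambda))$; $\Delta(u)=2\sqrt{\varepsilon_u}\sqrt{u\vee1}+\frac12\varepsilon_u$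 with $\varepsilon_u=\log((1+\kappa)/\delta)+2\log(1+\log_2(u\vee1))$.
   Formalization: The integral defining Π is taken as a Riemann integral, so π is assumed Riemann integrable on bounded intervals; for merely measurable π the claim fails, since the model sees π only at the countably many points m^β k/m, which the Lebesgue mean ignores. *)

theory Defs
  imports "HOL-Probability.Probability"
begin

definition cdf_on_unit :: "(real \<Rightarrow> real) \<Rightarrow> bool" where
  "cdf_on_unit F \<longleftrightarrow>
     (\<exists>D. real_distribution D \<and> measure D {0..1} = 1 \<and> (\<forall>t\<in>{0..1}. F t = cdf D t))"

definition vct_params ::
    "(real \<Rightarrow> real) \<Rightarrow> real \<Rightarrow> (real \<Rightarrow> real) \<Rightarrow> (real \<Rightarrow> real) \<Rightarrow> bool" where
  "vct_params \<pi> \<beta> F0 F1 \<longleftrightarrow>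
     0 \<le> \<beta> \<and> \<beta> < 1 \<and>
     cdf_on_unit F0 \<and> cdf_on_unit F1 \<and> (\<forall>t\<in>{0..1}. F0 t \<le> t) \<and>
     set_borel_measurable borel {0..} \<pi> \<and>
     (\<forall>x\<ge>0. 0 \<le> \<pi> x \<and> \<pi> x < 1) \<and> \<pi> 0 > 0 \<and> (\<forall>x\<ge>1. \<pi> x = \<pi> 1)"

text \<open>The law of \<open>p k\<close> given \<open>H k = i\<close> is only constrained when \<open>H k = i\<close> has positive
  probability.\<close>

definition vct_model ::
    "(real \<Rightarrow> real) \<Rightarrow> real \<Rightarrow> (real \<Rightarrow> real) \<Rightarrow> (real \<Rightarrow> real) \<Rightarrow> nat \<Rightarrow>
     'a measure \<Rightarrow> (nat \<Rightarrow> 'a \<Rightarrow> real) \<Rightarrow> (nat \<Rightarrow> 'a \<Rightarrow> nat) \<Rightarrow> bool" where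
  "vct_model \<pi> \<beta> F0 F1 m M p H \<longleftrightarrow>
     prob_space M \<and>
     prob_space.indep_vars M (\<lambda>_. borel \<Otimes>\<^sub>M count_space UNIV) (\<lambda>k \<omega>. (p k \<omega>, H k \<omega>)) {1..m} \<and>
     (\<forall>k\<in>{1..m}.
        (\<forall>\<omega>\<in>space M. p k \<omega> \<in> {0..1} \<and> H k \<omega> \<in> {0, 1}) \<and>
        \<P>(\<omega> in M. H k \<omega> = 1) = \<pi> (real m powr \<beta> * real k / real m) \<and>
        (\<P>(\<omega> in M. H k \<omega> = 0) > 0 \<longrightarrow>
           (\<forall>t\<in>{0..1}. \<P>(\<omega> in M. p k \<omega> \<le> t \<bar> H k \<omega> = 0) = F0 t)) \<and>
        (\<P>(\<omega> in M. H k \<omega> = 1) > 0 \<longrightarrow>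
           (\<forall>t\<in>{0..1}. \<P>(\<omega> in M. p k \<omega> \<le> t \<bar> H k \<omega> = 1) = F1 t)))"

text \<open>The Riemann integral: the library's gauge integral restricted to constant gauges.\<close>

definition has_riemann_integral :: "(real \<Rightarrow> real) \<Rightarrow> real \<Rightarrow> real \<Rightarrow> real \<Rightarrow> bool" where
  "has_riemann_integral f I a b \<longleftrightarrow>
     (\<forall>e>0. \<exists>d>0. \<forall>D. D tagged_division_of {a..b} \<and> (\<lambda>x. ball x d) fine D \<longrightarrow>
        \<bar>(\<Sum>(x, K)\<in>D. measure lborel K * f x) - I\<bar> < e)"

text \<open>\<open>PI t\<close> is the mean of \<open>\<pi>\<close> over \<open>[0, t]\<close>, with a Riemann integral. The model only sees \<open>\<pi>\<close>
  on the countable set of points \<open>m\<^sup>\<beta> k / m\<close>. A Lebesgue mean does not change when \<open>\<pi>\<close> is set to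
  \<open>0\<close> at those of them in \<open>(0, 1)\<close>, so it need not be related to the fraction of signal in the
  model; a Riemann mean is the limit of the grid averages.\<close>

definition running_mean :: "(real \<Rightarrow> real) \<Rightarrow> (real \<Rightarrow> real) \<Rightarrow> bool" where
  "running_mean \<pi> PI \<longleftrightarrow>
     PI 0 = \<pi> 0 \<and> (\<forall>t>0. \<exists>I. has_riemann_integral \<pi> I 0 t \<and> PI t = I / t)"

text \<open>Below, \<open>q i\<close> is the observed value of the \<open>i\<close>-th p-value, \<open>i \<ge> 1\<close>.\<close>

definition n_le :: "real \<Rightarrow> (nat \<Rightarrow> real) \<Rightarrow> nat \<Rightarrow> nat" where
  "n_le s q k = (\<Sum>i=1..k. of_bool (q i \<le> s))"

definition n_gt :: "real \<Rightarrow> (nat \<Rightarrow> real) \<Rightarrow> nat \<Rightarrow> nat" where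
  "n_gt lam q k = (\<Sum>i=1..k. of_bool (q i > lam))"

definition FDP_hat :: "real \<Rightarrow> real \<Rightarrow> (nat \<Rightarrow> real) \<Rightarrow> nat \<Rightarrow> real" where
  "FDP_hat s lam q k = s / (1 - lam) * ((1 + real (n_gt lam q k)) / max 1 (real (n_le s q k)))"

definition k_hat :: "real \<Rightarrow> real \<Rightarrow> real \<Rightarrow> nat \<Rightarrow> (nat \<Rightarrow> real) \<Rightarrow> nat" where
  "k_hat s lam \<alpha> m q =
     (let K = {k\<in>{0..m}. FDP_hat s lam q k \<le> \<alpha>} in if K = {} then 0 else Max K)"

definition r_hat :: "real \<Rightarrow> real \<Rightarrow> real \<Rightarrow> nat \<Rightarrow> (nat \<Rightarrow> real) \<Rightarrow> nat" where
  "r_hat s lam \<alpha> m q = n_le s q (k_hat s lam \<alpha> m q)"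

definition kappa :: real where
  "kappa = pi\<^sup>2 / 6"

definition delta_a :: "real \<Rightarrow> nat \<Rightarrow> real" where
  "delta_a \<delta> a = \<delta> / (kappa * (real a)\<^sup>2)"

definition KR_factor :: "real \<Rightarrow> real \<Rightarrow> nat \<Rightarrow> real" where
  "KR_factor \<delta> B a =
     ln (1 / delta_a \<delta> a) / (real a * ln (1 + (1 - delta_a \<delta> a powr (B / real a)) / B))"

text \<open>The infimum is attained: the terms are positive and tend to infinity with \<open>a\<close>.\<close>

definition KRU_env :: "real \<Rightarrow> real \<Rightarrow> real \<Rightarrow> (nat \<Rightarrow> real) \<Rightarrow> nat \<Rightarrow> real" where
  "KRU_env s lam \<delta> q k =
     (if k = 0 then 0
      else min 1 (INF a\<in>{1..}. KR_factor \<delta> (s / (1 - lam)) a *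
             ((real a + s / (1 - lam) * real (n_gt lam q k)) / max 1 (real (n_le s q k)))))"

definition KRU_bound :: "real \<Rightarrow> real \<Rightarrow> real \<Rightarrow> real \<Rightarrow> nat \<Rightarrow> real" where
  "KRU_bound s lam \<delta> \<alpha> r =
     min 1 (MIN a\<in>{1..max 1 r}. KR_factor \<delta> (s / (1 - lam)) a *
             (\<alpha> + real a / max 1 (real r)))"

definition eps_u :: "real \<Rightarrow> real \<Rightarrow> real" where
  "eps_u \<delta> u = ln ((1 + kappa) / \<delta>) + 2 * ln (1 + log 2 (max u 1))"

definition Delta :: "real \<Rightarrow> real \<Rightarrow> real" where
  "Delta \<delta> u = 2 * sqrt (eps_u \<delta> u) * sqrt (max u 1) + eps_u \<delta> u / 2"

definition nu :: "real \<Rightarrow> real \<Rightarrow> real" where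
  "nu s lam = s * (1 + s / (1 - lam))"

text \<open>The numerator is positive, so a zero denominator makes the ratio infinite and the envelope
  equal to \<open>1\<close>.\<close>

definition Freed_env :: "real \<Rightarrow> real \<Rightarrow> real \<Rightarrow> (nat \<Rightarrow> real) \<Rightarrow> nat \<Rightarrow> real" where
  "Freed_env s lam \<delta> q k =
     (if k = 0 then 0
      else if n_le s q k = 0 then 1
      else min 1 ((s / (1 - lam) * real (n_gt lam q k) + Delta \<delta> (nu s lam * real k))
                    / real (n_le s q k)))"

definition Freed_bound :: "real \<Rightarrow> real \<Rightarrow> real \<Rightarrow> real \<Rightarrow> nat \<Rightarrow> nat \<Rightarrow> real" where
  "Freed_bound s lam \<delta> \<alpha> k r =
     min 1 (\<alpha> + Delta \<delta> (nu s lam * real k) / max 1 (real r))"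

definition consistent ::
    "(nat \<Rightarrow> 'a measure) \<Rightarrow> (nat \<Rightarrow> nat \<Rightarrow> 'a \<Rightarrow> real) \<Rightarrow> real \<Rightarrow>
     (nat \<Rightarrow> (nat \<Rightarrow> real) \<Rightarrow> real) \<Rightarrow> bool" where
  "consistent M p \<alpha> FDP_bar \<longleftrightarrow>
     (\<forall>\<epsilon>>0. (\<lambda>m. \<P>(\<omega> in M m. FDP_bar m (\<lambda>i. p m i \<omega>) - \<alpha> \<ge> \<epsilon>)) \<longlonglongrightarrow> 0)"

end

theory Submission
  imports Defs "HOL-Real_Asymp.Real_Asymp"
begin

text \<open>
  Fix \<open>x\<close> slightly below \<open>\<pi> 0\<close> such that the asymptotic false discovery estimate at signal fraction
  \<open>x\<close> is still below \<open>\<alpha>\<close>. As \<open>PI\<close> is continuous at \<open>0\<close> and is a Riemann mean, for a small fixed \<open>t\<close> the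
  first \<open>k \<approx> t m\<^bsup>1-\<beta>\<^esup>\<close> hypotheses have average signal probability at least \<open>x\<close>. Hoeffding's inequality
  then gives \<open>FDP_hat k \<le> \<alpha>\<close> with probability tending to \<open>1\<close>, so the procedure makes at least
  \<open>n_le s q k \<ge> c m\<^bsup>1-\<beta>\<^esup>\<close> rejections. The rest is deterministic: \<open>KR_factor\<close> tends to \<open>1\<close>, which
  controls the KR-U bound as the number \<open>r\<close> of rejections grows, and \<open>Delta u\<close> is of smaller order than
  \<open>u\<^bsup>\<gamma>\<^esup>\<close> for every \<open>\<gamma> > 1/2\<close>. For \<open>\<beta> < 1/2\<close> this is compared with \<open>k_hat \<le> m\<close>; for \<open>lam = s\<close>
  one uses \<open>n_gt = k - n_le\<close>, whence \<open>k_hat\<close> is at most a multiple of \<open>r\<close>.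
\<close>

section \<open>Deterministic bounds\<close>

lemma kappa_gt_1: "kappa > 1"
proof -
  have "3 ^ 2 \<le> pi ^ 2"
    using pi_approx by (intro power_mono) auto
  then show ?thesis
    by (simp add: kappa_def)
qed

lemma delta_a_bounds:
  assumes "0 < \<delta>" "\<delta> < 1" "a \<ge> 1"
  shows "0 < delta_a \<delta> a" "delta_a \<delta> a < 1"
proof -
  have "1 * 1 \<le> kappa * (real a)\<^sup>2"
    using kappa_gt_1 assms by (intro mult_mono) auto
  then show "0 < delta_a \<delta> a" "delta_a \<delta> a < 1"
    using assms kappa_gt_1 by (auto simp: delta_a_def divide_simps)
qed

text \<open>A power of \<open>delta_a \<delta> a < 1\<close> with nonnegative exponent is at most 1,
  so both logarithms are nonnegative. The sign is what allows inequalities to be multiplied by the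
  factor and gives the lower bound 0 for the infimum over \<open>a\<close>.\<close>

lemma KR_factor_nonneg:
  assumes "0 < \<delta>" "\<delta> < 1" "0 < B" "a \<ge> 1"
  shows "KR_factor \<delta> B a \<ge> 0"
proof -
  note d = delta_a_bounds[OF assms(1,2,4)]
  have "delta_a \<delta> a powr (B / real a) \<le> delta_a \<delta> a powr 0"
    using d assms by (intro powr_mono') auto
  then have "1 + (1 - delta_a \<delta> a powr (B / real a)) / B \<ge> 1"
    using d assms by simp
  then show ?thesis
    unfolding KR_factor_def using d by (intro divide_nonneg_nonneg mult_nonneg_nonneg) auto
qed

text \<open>Put l = ln (1 / \<open>delta_a \<delta> a\<close>), which grows like 2 ln a. The power
  in the denominator is exp (-B l / a) = 1 - B l / a + o(l / a), so the denominator is a ln (1 + l /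
  a + o(l / a)), asymptotically equal to l.\<close>

lemma KR_factor_tendsto_1:
  assumes "0 < \<delta>" "0 < B"
  shows "(\<lambda>a. KR_factor \<delta> B a) \<longlonglongrightarrow> 1"
proof -
  have "kappa > 0"
    using kappa_gt_1 by simp
  then have "((\<lambda>a::real. ln (1 / (\<delta> / (kappa * a\<^sup>2))) /
      (a * ln (1 + (1 - (\<delta> / (kappa * a\<^sup>2)) powr (B / a)) / B))) \<longlongrightarrow> 1) at_top"
    using assms by real_asymp
  from filterlim_compose[OF this filterlim_real_sequentially]
  show ?thesis
    unfolding KR_factor_def delta_a_def .
qed

text \<open>Covers the comparison with the envelope when \<open>k_hat\<close> is 0, where the
  envelope is 0 by convention.\<close>

lemma KRU_bound_nonneg:
  assumes "0 < \<delta>" "\<delta> < 1" "0 < s" "lam < 1" "0 < \<alpha>"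
  shows "KRU_bound s lam \<delta> \<alpha> r \<ge> 0"
  using assms unfolding KRU_bound_def
  by (auto intro!: mult_nonneg_nonneg add_nonneg_nonneg KR_factor_nonneg)

text \<open>One fixed \<open>a\<close> suffices: choose it with its factor close enough to 1. As
  \<open>r\<close> grows, the term a / r vanishes, and \<open>a\<close> lies in the range of the
  minimum as soon as \<open>r \<ge> a\<close>.\<close>

lemma KRU_bound_le_eventually:
  assumes "0 < \<delta>" "\<delta> < 1" "0 < s" "lam < 1" "0 < \<alpha>" "0 < \<epsilon>"
  shows "eventually (\<lambda>r. KRU_bound s lam \<delta> \<alpha> r < \<alpha> + \<epsilon>) sequentially"
proof -
  define f where "f = KR_factor \<delta> (s / (1 - lam))"
  have "(\<lambda>a. f a * \<alpha>) \<longlonglongrightarrow> 1 * \<alpha>"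
    unfolding f_def using assms by (intro tendsto_intros KR_factor_tendsto_1) auto
  then have "eventually (\<lambda>a. f a * \<alpha> < \<alpha> + \<epsilon>) sequentially"
    using assms by (intro order_tendstoD) auto
  then have "eventually (\<lambda>a. a \<ge> 1 \<and> f a * \<alpha> < \<alpha> + \<epsilon>) sequentially"
    by (intro eventually_conj eventually_ge_at_top)
  then obtain a where a: "a \<ge> 1" "f a * \<alpha> < \<alpha> + \<epsilon>"
    using eventually_happens'[OF sequentially_bot] by blast
  have "(\<lambda>r. f a * (\<alpha> + real a / max 1 (real r))) \<longlonglongrightarrow> f a * (\<alpha> + 0)"
  proof (intro tendsto_intros)
    have "(\<lambda>r. real a / real r) \<longlonglongrightarrow> 0"
      by (rule lim_const_over_n)
    moreover have "eventually (\<lambda>r. real a / real r = real a / max 1 (real r)) sequentially"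
      using eventually_ge_at_top[of 1] by eventually_elim simp
    ultimately show "(\<lambda>r. real a / max 1 (real r)) \<longlonglongrightarrow> 0"
      by (rule Lim_transform_eventually)
  qed
  then have "eventually (\<lambda>r. f a * (\<alpha> + real a / max 1 (real r)) < \<alpha> + \<epsilon>) sequentially"
    using a by (intro order_tendstoD) auto
  then show ?thesis
    using eventually_ge_at_top[of a]
  proof eventually_elim
    case (elim r)
    have "(MIN a\<in>{1..max 1 r}. f a * (\<alpha> + real a / max 1 (real r)))
            \<le> f a * (\<alpha> + real a / max 1 (real r))"
      using a elim by (intro Min_le) auto
    then show ?case
      using elim by (auto simp: KRU_bound_def f_def)
  qed
qed

section \<open>The stopping index and its defining inequality\<close>

lemma k_hat_le: "k_hat s lam \<alpha> m q \<le> m"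
  by (auto simp: k_hat_def Let_def)

text \<open>A nonzero value cannot be the default for the empty set, so it is the maximum of a
  nonempty finite set and belongs to it.\<close>

lemma FDP_hat_k_hat_le:
  assumes "k_hat s lam \<alpha> m q \<noteq> 0"
  shows "FDP_hat s lam q (k_hat s lam \<alpha> m q) \<le> \<alpha>"
proof -
  define K where "K = {k\<in>{0..m}. FDP_hat s lam q k \<le> \<alpha>}"
  have "K \<noteq> {}" "k_hat s lam \<alpha> m q = Max K"
    using assms by (auto simp: k_hat_def Let_def K_def split: if_splits)
  moreover have "finite K"
    by (auto simp: K_def)
  ultimately have "k_hat s lam \<alpha> m q \<in> K"
    by simp
  then show ?thesis
    by (simp add: K_def)
qed

lemma k_hat_ge:
  assumes "k \<le> m" "FDP_hat s lam q k \<le> \<alpha>"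
  shows "k \<le> k_hat s lam \<alpha> m q"
proof -
  have "k \<in> {k\<in>{0..m}. FDP_hat s lam q k \<le> \<alpha>}"
    using assms by simp
  then show ?thesis
    unfolding k_hat_def Let_def by (auto intro!: Max_ge)
qed

lemma n_le_mono: "k \<le> l \<Longrightarrow> n_le s q k \<le> n_le s q l"
  unfolding n_le_def by (rule sum_mono2) auto

lemma n_gt_le_at_k_hat:
  assumes "k_hat s lam \<alpha> m q \<noteq> 0"
  shows "s / (1 - lam) * (1 + real (n_gt lam q (k_hat s lam \<alpha> m q)))
           \<le> \<alpha> * max 1 (real (r_hat s lam \<alpha> m q))"
proof -
  define R where "R = max 1 (real (r_hat s lam \<alpha> m q))"
  have "R > 0"
    by (simp add: R_def)
  then show ?thesis
    using FDP_hat_k_hat_le[OF assms] unfolding FDP_hat_def r_hat_def[symmetric] R_def[symmetric]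
    by (simp only: times_divide_eq_right pos_divide_le_eq)
qed

text \<open>The stopping inequality replaces \<open>B * n_gt\<close> by \<open>\<alpha> * R\<close>
  in each term, and an infimum over all \<open>a \<ge> 1\<close> is at most the minimum over a
  finite part of that range.\<close>

lemma KRU_env_le_bound:
  assumes "0 < \<delta>" "\<delta> < 1" "0 < s" "lam < 1" "0 < \<alpha>"
  shows "KRU_env s lam \<delta> q (k_hat s lam \<alpha> m q) \<le> KRU_bound s lam \<delta> \<alpha> (r_hat s lam \<alpha> m q)"
proof (cases "k_hat s lam \<alpha> m q = 0")
  case True
  then show ?thesis
    using KRU_bound_nonneg[OF assms] by (simp add: KRU_env_def)
next
  case False
  define k where "k = k_hat s lam \<alpha> m q"
  define R where "R = max 1 (real (r_hat s lam \<alpha> m q))"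
  define B where "B = s / (1 - lam)"
  define f where "f = (\<lambda>a. KR_factor \<delta> B a * ((real a + B * real (n_gt lam q k)) / R))"
  have B: "B > 0" and R: "R \<ge> 1"
    using assms by (auto simp: B_def R_def)
  \<comment> \<open>The infimum of reals is meaningful only for sets bounded below; the terms are
    nonnegative.\<close>
  have bd: "bdd_below (f ` {1..})"
    using B R assms unfolding f_def
    by (intro bdd_belowI[of _ 0])
       (auto intro!: mult_nonneg_nonneg divide_nonneg_nonneg add_nonneg_nonneg KR_factor_nonneg)
  \<comment> \<open>The stopping inequality has \<open>1 + n_gt\<close> on the left; the extra
    \<open>B\<close> is dropped.\<close>
  have "B * real (n_gt lam q k) \<le> \<alpha> * R"
    using n_gt_le_at_k_hat[OF False] B by (simp add: B_def R_def k_def algebra_simps)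
  then have frac: "(real a + B * real (n_gt lam q k)) / R \<le> \<alpha> + real a / R" for a
    using R by (simp add: divide_simps algebra_simps)
  have le: "(INF a\<in>{1..}. f a) \<le> KR_factor \<delta> B a * (\<alpha> + real a / R)" if "a \<ge> 1" for a
  proof -
    have "(INF a\<in>{1..}. f a) \<le> f a"
      using bd that by (intro cINF_lower) auto
    also have "\<dots> \<le> KR_factor \<delta> B a * (\<alpha> + real a / R)"
      unfolding f_def using frac that B assms by (intro mult_left_mono KR_factor_nonneg) auto
    finally show ?thesis .
  qed
  have "(INF a\<in>{1..}. f a)
          \<le> (MIN a\<in>{1..max 1 (r_hat s lam \<alpha> m q)}. KR_factor \<delta> B a * (\<alpha> + real a / R))"
    using le by (intro Min.boundedI) auto
  then show ?thesis
    using False by (auto simp: KRU_env_def KRU_bound_def f_def B_def R_def k_def r_hat_def)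
qed

section \<open>Growth of \<open>Delta\<close> and the Freedman bound\<close>

lemma eps_u_nonneg:
  assumes "0 < \<delta>" "\<delta> < 1"
  shows "eps_u \<delta> u \<ge> 0"
  using assms kappa_gt_1 by (auto simp: eps_u_def divide_simps intro!: add_nonneg_nonneg ln_ge_zero)

lemma eps_u_mono:
  assumes "u \<le> v"
  shows "eps_u \<delta> u \<le> eps_u \<delta> v"
proof -
  have "log 2 (max u 1) \<le> log 2 (max v 1)" "0 \<le> log 2 (max u 1)"
    using assms by (auto simp: max_def)
  then have "ln (1 + log 2 (max u 1)) \<le> ln (1 + log 2 (max v 1))"
    by (subst ln_le_cancel_iff) linarith+
  then show ?thesis
    by (simp add: eps_u_def)
qed

lemma Delta_mono:
  assumes "0 < \<delta>" "\<delta> < 1" "u \<le> v"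
  shows "Delta \<delta> u \<le> Delta \<delta> v"
  using assms(3) eps_u_mono[OF assms(3), of \<delta>] eps_u_nonneg[OF assms(1,2)] unfolding Delta_def
  by (intro add_mono mult_mono) auto

text \<open>Since \<open>eps_u\<close> grows like log log u, \<open>Delta\<close> has order sqrt (u
  log log u). For u at least 1 the truncation \<open>max u 1\<close> disappears.\<close>

lemma Delta_div_powr_tendsto_0:
  assumes "\<gamma> > 1 / 2"
  shows "((\<lambda>u. Delta \<delta> u / u powr \<gamma>) \<longlongrightarrow> 0) at_top"
proof -
  define A where "A = ln ((1 + kappa) / \<delta>)"
  have "((\<lambda>u. (2 * sqrt (A + 2 * ln (1 + log 2 u)) * sqrt u +
          (A + 2 * ln (1 + log 2 u)) / 2) / u powr \<gamma>) \<longlongrightarrow> 0) at_top"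
    using assms by real_asymp
  then show ?thesis
    by (rule Lim_transform_eventually)
       (auto intro!: eventually_mono[OF eventually_ge_at_top[of 1]]
         simp: Delta_def eps_u_def A_def max_def)
qed

lemma Delta_le_powr_eventually:
  assumes "\<gamma> > 1 / 2" "0 < c" "0 < \<epsilon>"
  shows "eventually (\<lambda>n. Delta \<delta> (c * real n) < \<epsilon> * real n powr \<gamma>) sequentially"
proof -
  have "filterlim (\<lambda>n. c * real n) at_top sequentially"
    using assms by real_asymp
  from filterlim_compose[OF Delta_div_powr_tendsto_0[OF assms(1)] this]
  have "(\<lambda>n. Delta \<delta> (c * real n) / (c * real n) powr \<gamma>) \<longlonglongrightarrow> 0" .
  then have "eventually (\<lambda>n. Delta \<delta> (c * real n) / (c * real n) powr \<gamma> < \<epsilon> / c powr \<gamma>) sequentially"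
    using assms by (intro order_tendstoD) auto
  then show ?thesis
    using eventually_gt_at_top[of 0]
    by eventually_elim (use assms in \<open>simp add: powr_mult field_simps\<close>)
qed

text \<open>Serves twice: to bound \<open>k_hat\<close> when \<open>lam = s\<close>, and to turn an
  upper tail of \<open>n_gt\<close> into a lower tail of \<open>n_le\<close>.\<close>

lemma n_le_add_n_gt: "n_le s q k + n_gt s q k = k"
proof -
  have "n_le s q k + n_gt s q k = (\<Sum>i=1..k. 1)"
    unfolding n_le_def n_gt_def sum.distrib[symmetric] by (intro sum.cong) auto
  then show ?thesis
    by simp
qed

text \<open>A nonzero \<open>r_hat\<close> rules out both special cases of the envelope and gives
  \<open>max 1 r = r\<close>; the stopping inequality then bounds the first summand of the numerator
  by \<open>\<alpha> * r\<close>.\<close>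

lemma Freed_env_le_bound:
  assumes "0 < \<delta>" "\<delta> < 1" "0 < s" "lam < 1" "0 < \<alpha>" "r_hat s lam \<alpha> m q \<noteq> 0"
  shows "Freed_env s lam \<delta> q (k_hat s lam \<alpha> m q)
           \<le> Freed_bound s lam \<delta> \<alpha> (k_hat s lam \<alpha> m q) (r_hat s lam \<alpha> m q)"
proof -
  define k where "k = k_hat s lam \<alpha> m q"
  define r where "r = r_hat s lam \<alpha> m q"
  have "k \<noteq> 0"
    using assms(6) by (auto simp: k_def r_hat_def n_le_def)
  have r: "real r \<ge> 1"
    using assms(6) by (simp add: r_def)
  have "s / (1 - lam) * (1 + real (n_gt lam q k)) \<le> \<alpha> * real r"
    using n_gt_le_at_k_hat[of s lam \<alpha> m q] \<open>k \<noteq> 0\<close> r by (simp add: k_def r_def)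
  moreover have "s / (1 - lam) * (1 + real (n_gt lam q k)) \<ge> s / (1 - lam) * real (n_gt lam q k)"
    using assms by (intro mult_left_mono) auto
  ultimately have "(s / (1 - lam) * real (n_gt lam q k) + Delta \<delta> (nu s lam * real k)) / real r
      \<le> (\<alpha> * real r + Delta \<delta> (nu s lam * real k)) / real r"
    using r by (intro divide_right_mono) auto
  also have "\<dots> = \<alpha> + Delta \<delta> (nu s lam * real k) / max 1 (real r)"
    using r by (simp add: add_divide_distrib)
  finally have *: "(s / (1 - lam) * real (n_gt lam q k) + Delta \<delta> (nu s lam * real k)) / real r
      \<le> \<alpha> + Delta \<delta> (nu s lam * real k) / max 1 (real r)" .
  have "Freed_env s lam \<delta> q k
      = min 1 ((s / (1 - lam) * real (n_gt lam q k) + Delta \<delta> (nu s lam * real k)) / real r)"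
    using \<open>k \<noteq> 0\<close> assms(6) by (simp add: Freed_env_def r_hat_def r_def k_def)
  then show ?thesis
    using * unfolding Freed_bound_def k_def[symmetric] r_def[symmetric] by linarith
qed

text \<open>At equal thresholds \<open>k_hat\<close> is \<open>r_hat\<close> plus the number of
  p-values above \<open>s\<close>, and the stopping inequality bounds the latter by a multiple of
  \<open>r_hat\<close>.\<close>

lemma k_hat_le_r_hat:
  assumes "0 < s" "s < 1" "0 < \<alpha>" "r_hat s s \<alpha> m q \<noteq> 0"
  shows "real (k_hat s s \<alpha> m q) \<le> (1 + \<alpha> * (1 - s) / s) * real (r_hat s s \<alpha> m q)"
proof -
  define k where "k = k_hat s s \<alpha> m q"
  define r where "r = r_hat s s \<alpha> m q"
  have "k \<noteq> 0"
    using assms(4) by (auto simp: k_def r_hat_def n_le_def)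
  then have "s / (1 - s) * (1 + real (n_gt s q k)) \<le> \<alpha> * real r"
    using n_gt_le_at_k_hat[of s s \<alpha> m q] assms(4) by (simp add: k_def r_def)
  then have "1 + real (n_gt s q k) \<le> \<alpha> * (1 - s) / s * real r"
    using assms by (simp add: field_simps)
  moreover have "real k = real r + real (n_gt s q k)"
    using n_le_add_n_gt[of s q k] unfolding r_def r_hat_def k_def by linarith
  ultimately show ?thesis
    by (simp add: k_def r_def algebra_simps)
qed

lemma nu_pos: "0 < s \<Longrightarrow> lam < 1 \<Longrightarrow> 0 < nu s lam"
  by (auto simp: nu_def intro!: mult_pos_pos add_pos_pos)

lemma Freed_bound_less:
  assumes "Delta \<delta> (nu s lam * real k) < \<epsilon> * max 1 (real r)"
  shows "Freed_bound s lam \<delta> \<alpha> k r < \<alpha> + \<epsilon>"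
proof -
  have "Delta \<delta> (nu s lam * real k) / max 1 (real r) < \<epsilon>"
    using assms by (subst pos_divide_less_eq) auto
  then show ?thesis
    unfolding Freed_bound_def by linarith
qed

text \<open>The statement is deterministic and uniform in \<open>q\<close>. If
  \<open>\<beta> < 1 / 2\<close>, then \<open>k_hat \<le> m\<close> and 1 - \<beta> > 1/2, so
  \<open>Delta\<close> at a multiple of m is negligible against the lower bound for
  \<open>r_hat\<close>. If \<open>lam = s\<close>, then \<open>k_hat\<close> is at most a multiple
  of \<open>r_hat\<close>, and \<open>Delta\<close> at a multiple of r is o(r).\<close>

lemma Freed_bound_le_eventually:
  assumes "0 < \<delta>" "\<delta> < 1" "0 < s" "lam < 1" "0 < \<alpha>" "\<beta> < 1" "0 < c" "0 < \<epsilon>"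
    and "lam = s \<or> \<beta> < 1 / 2"
  shows "eventually (\<lambda>m. \<forall>q. real (r_hat s lam \<alpha> m q) \<ge> c * real m powr (1 - \<beta>) \<longrightarrow>
           Freed_bound s lam \<delta> \<alpha> (k_hat s lam \<alpha> m q) (r_hat s lam \<alpha> m q) < \<alpha> + \<epsilon>) sequentially"
  using assms(9)
proof
  assume \<beta>: "\<beta> < 1 / 2"
  have "eventually (\<lambda>m. Delta \<delta> (nu s lam * real m) < (\<epsilon> * c) * real m powr (1 - \<beta>)) sequentially"
    using assms \<beta> nu_pos[of s lam] by (intro Delta_le_powr_eventually) auto
  then show ?thesis
  proof eventually_elim
    case (elim m)
    show ?case
    proof (intro allI impI)
      fix q
      assume r: "c * real m powr (1 - \<beta>) \<le> real (r_hat s lam \<alpha> m q)"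
      have "Delta \<delta> (nu s lam * real (k_hat s lam \<alpha> m q)) \<le> Delta \<delta> (nu s lam * real m)"
        using assms nu_pos[of s lam] k_hat_le by (intro Delta_mono mult_left_mono) auto
      also have "\<dots> < \<epsilon> * (c * real m powr (1 - \<beta>))"
        using elim by (simp add: mult_ac)
      also have "\<dots> \<le> \<epsilon> * max 1 (real (r_hat s lam \<alpha> m q))"
        using r assms by (intro mult_left_mono) auto
      finally show "Freed_bound s lam \<delta> \<alpha> (k_hat s lam \<alpha> m q) (r_hat s lam \<alpha> m q) < \<alpha> + \<epsilon>"
        by (rule Freed_bound_less)
    qed
  qed
next
  assume lam: "lam = s"
  define C where "C = 1 + \<alpha> * (1 - s) / s"
  have C: "C > 0"
    using assms lam by (auto simp: C_def intro!: add_pos_nonneg)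
  have "eventually (\<lambda>n. Delta \<delta> (nu s lam * C * real n) < \<epsilon> * real n powr 1) sequentially"
    using assms C nu_pos[of s lam] by (intro Delta_le_powr_eventually) auto
  then obtain N where N: "\<And>n. n \<ge> N \<Longrightarrow> Delta \<delta> (nu s lam * C * real n) < \<epsilon> * real n"
    by (auto simp: eventually_sequentially)
  have "filterlim (\<lambda>m. c * real m powr (1 - \<beta>)) at_top sequentially"
    using assms by real_asymp
  \<comment> \<open>The 1 in the maximum makes \<open>r_hat\<close> nonzero, as
    \<open>k_hat_le_r_hat\<close> requires.\<close>
  then have "eventually (\<lambda>m. real (max N 1) \<le> c * real m powr (1 - \<beta>)) sequentially"
    by (simp add: filterlim_at_top)
  then show ?thesis
  proof eventually_elim
    case (elim m)
    show ?case
    proof (intro allI impI)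
      fix q
      assume "c * real m powr (1 - \<beta>) \<le> real (r_hat s lam \<alpha> m q)"
      with elim have r: "N \<le> r_hat s lam \<alpha> m q" "1 \<le> r_hat s lam \<alpha> m q"
        by linarith+
      have "nu s lam * real (k_hat s lam \<alpha> m q) \<le> nu s lam * (C * real (r_hat s lam \<alpha> m q))"
        using assms nu_pos[of s lam] k_hat_le_r_hat[of s \<alpha> m q] r lam
        by (intro mult_left_mono) (auto simp: C_def)
      then have "Delta \<delta> (nu s lam * real (k_hat s lam \<alpha> m q))
          \<le> Delta \<delta> (nu s lam * C * real (r_hat s lam \<alpha> m q))"
        using assms by (intro Delta_mono) (auto simp: mult_ac)
      also have "\<dots> < \<epsilon> * real (r_hat s lam \<alpha> m q)"
        using r by (intro N)
      also have "\<dots> \<le> \<epsilon> * max 1 (real (r_hat s lam \<alpha> m q))"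
        using assms by (intro mult_left_mono) auto
      finally show "Freed_bound s lam \<delta> \<alpha> (k_hat s lam \<alpha> m q) (r_hat s lam \<alpha> m q) < \<alpha> + \<epsilon>"
        by (rule Freed_bound_less)
    qed
  qed
qed

section \<open>Riemann sums and concentration\<close>

text \<open>Degenerate cells are allowed because the grid used later is cut off at its right end,
  where the last cell may be a single point.\<close>

lemma tagged_division_of_grid:
  fixes x :: "nat \<Rightarrow> real"
  assumes "mono x" "N > 0"
  shows "(\<lambda>i. (x (Suc i), {x i..x (Suc i)})) ` {..<N} tagged_division_of {x 0..x N}"
proof (rule tagged_division_ofI)
  have mono: "x i \<le> x j" if "i \<le> j" for i j
    using assms(1) that by (auto dest: monoD)
  show "finite ((\<lambda>i. (x (Suc i), {x i..x (Suc i)})) ` {..<N})"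
    by simp
  fix y K
  assume "(y, K) \<in> (\<lambda>i. (x (Suc i), {x i..x (Suc i)})) ` {..<N}"
  then obtain i where i: "i < N" "y = x (Suc i)" "K = {x i..x (Suc i)}"
    by auto
  show "y \<in> K"
    using i mono[of i "Suc i"] by auto
  show "K \<subseteq> {x 0..x N}"
    using i mono[of 0 i] mono[of "Suc i" N] by auto
  show "\<exists>a b. K = cbox a b"
    using i by auto
  fix z K'
  assume "(z, K') \<in> (\<lambda>i. (x (Suc i), {x i..x (Suc i)})) ` {..<N}"
  then obtain j where j: "j < N" "z = x (Suc j)" "K' = {x j..x (Suc j)}"
    by auto
  assume "(y, K) \<noteq> (z, K')"
  then have "i \<noteq> j"
    using i j by auto
  then show "interior K \<inter> interior K' = {}"
    using i j mono[of "Suc i" j] mono[of "Suc j" i] by (cases "i < j") auto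
next
  have "y \<in> {x 0..x (Suc n)} \<Longrightarrow> \<exists>i<Suc n. y \<in> {x i..x (Suc i)}" for y n
  proof (induction n)
    case (Suc n)
    show ?case
    proof (cases "y \<le> x (Suc n)")
      case True
      with Suc obtain i where "i < Suc n" "y \<in> {x i..x (Suc i)}"
        by auto
      then show ?thesis
        by (intro exI[of _ i]) auto
    next
      case False
      with Suc show ?thesis
        by (intro exI[of _ "Suc n"]) auto
    qed
  qed auto
  from this[of _ "N - 1"] have "{x 0..x N} \<subseteq> (\<Union>i<N. {x i..x (Suc i)})"
    using assms(2) by fastforce
  moreover have "(\<Union>i<N. {x i..x (Suc i)}) \<subseteq> {x 0..x N}"
  proof (intro UN_least)
    fix i
    assume "i \<in> {..<N}"
    then show "{x i..x (Suc i)} \<subseteq> {x 0..x N}"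
      using monoD[OF assms(1), of 0 i] monoD[OF assms(1), of "Suc i" N] by auto
  qed
  moreover have "\<Union> {K. \<exists>y. (y, K) \<in> (\<lambda>i. (x (Suc i), {x i..x (Suc i)})) ` {..<N}}
      = (\<Union>i<N. {x i..x (Suc i)})"
    by auto
  ultimately show "\<Union> {K. \<exists>y. (y, K) \<in> (\<lambda>i. (x (Suc i), {x i..x (Suc i)})) ` {..<N}} = {x 0..x N}"
    by simp
qed

lemma riemann_sum_grid:
  assumes "has_riemann_integral f I a b" "e > 0"
  obtains d where "d > 0"
    and "\<And>x N. mono x \<Longrightarrow> x 0 = a \<Longrightarrow> x N = b \<Longrightarrow> N > 0 \<Longrightarrow> (\<And>i. i < N \<Longrightarrow> x (Suc i) - x i < d) \<Longrightarrow>
           \<bar>(\<Sum>i<N. (x (Suc i) - x i) * f (x (Suc i))) - I\<bar> < e"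
proof -
  obtain d where d: "d > 0"
    and D: "\<And>D. D tagged_division_of {a..b} \<Longrightarrow> (\<lambda>x. ball x d) fine D \<Longrightarrow>
        \<bar>(\<Sum>(x, K)\<in>D. measure lborel K * f x) - I\<bar> < e"
    using assms(1)[unfolded has_riemann_integral_def, THEN spec, THEN mp, OF assms(2)]
    by (elim exE conjE) simp
  show ?thesis
  proof (rule that[OF d])
    fix x :: "nat \<Rightarrow> real" and N :: nat
    assume x: "mono x" "x 0 = a" "x N = b" "N > 0" "\<And>i. i < N \<Longrightarrow> x (Suc i) - x i < d"
    have mono: "x i \<le> x j" if "i \<le> j" for i j
      using x(1) that by (auto dest: monoD)
    define g where "g = (\<lambda>i. (x (Suc i), {x i..x (Suc i)}))"
    have "g ` {..<N} tagged_division_of {a..b}"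
      using tagged_division_of_grid[OF x(1,4)] x(2,3) by (simp add: g_def)
    moreover have "(\<lambda>x. ball x d) fine (g ` {..<N})"
      using x(5) by (force simp: fine_def g_def dist_real_def)
    ultimately have "\<bar>(\<Sum>(x, K)\<in>g ` {..<N}. measure lborel K * f x) - I\<bar> < e"
      by (rule D)
    also have "(\<Sum>(x, K)\<in>g ` {..<N}. measure lborel K * f x)
        = (\<Sum>i<N. (x (Suc i) - x i) * f (x (Suc i)))"
    \<comment> \<open>The map \<open>g\<close> may fail to be injective, but two indices with the
      same image give a cell of length 0, which contributes nothing.\<close>
    proof (subst sum.reindex_nontrivial)
      fix i j
      assume "i \<in> {..<N}" "j \<in> {..<N}" "i \<noteq> j" "g i = g j"
      then have "x i = x (Suc i)"
        using mono[of i "Suc i"] mono[of j "Suc j"] mono[of "Suc i" j] mono[of "Suc j" i]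
        by (cases "i < j") (auto simp: g_def Icc_eq_Icc)
      then show "(case g i of (x, K) \<Rightarrow> measure lborel K * f x) = 0"
        by (simp add: g_def)
    qed (use mono in \<open>auto simp: g_def intro!: sum.cong\<close>)
    finally show "\<bar>(\<Sum>i<N. (x (Suc i) - x i) * f (x (Suc i))) - I\<bar> < e" .
  qed
qed

text \<open>The multiples of \<open>h\<close> up to \<open>t\<close> leave one incomplete cell at
  the right end. Its contribution is at most its length, which is below \<open>h\<close>, because
  \<open>f t \<le> 1\<close>.\<close>

lemma riemann_integral_le_grid_sum:
  assumes "has_riemann_integral f I 0 t" "t > 0" "f t \<le> 1" "e > 0"
  obtains d where "d > 0"
    and "\<And>h. 0 < h \<Longrightarrow> h < d \<Longrightarrow> I - e \<le> h * (\<Sum>i=1..nat \<lfloor>t / h\<rfloor>. f (h * real i))"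
proof -
  from assms(4) have "e / 2 > 0"
    by simp
  then obtain d where d: "d > 0"
    and D: "\<And>x N. mono x \<Longrightarrow> x 0 = 0 \<Longrightarrow> x N = t \<Longrightarrow> N > 0 \<Longrightarrow> (\<And>i. i < N \<Longrightarrow> x (Suc i) - x i < d) \<Longrightarrow>
           \<bar>(\<Sum>i<N. (x (Suc i) - x i) * f (x (Suc i))) - I\<bar> < e / 2"
    using riemann_sum_grid[OF assms(1)] by blast
  show ?thesis
  \<comment> \<open>The first bound makes the grid fine; the second makes the incomplete cell cost
    less than \<open>e / 2\<close>.\<close>
  proof (rule that[of "min d (e / 2)"])
    show "min d (e / 2) > 0"
      using d assms by simp
    fix h :: real
    assume h: "0 < h" "h < min d (e / 2)"
    define k where "k = nat \<lfloor>t / h\<rfloor>"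
    \<comment> \<open>Truncation at \<open>t\<close> makes index \<open>Suc k\<close> hit the
      endpoint exactly.\<close>
    define x where "x = (\<lambda>i. min (h * real i) t)"
    have k: "real k \<le> t / h" "t / h < real k + 1"
      using h assms(2) by (auto simp: k_def)
    have hk: "h * real k \<le> t" "t < h * (real k + 1)"
      using k h by (auto simp: field_simps)
    have xle: "x i = h * real i" if "i \<le> k" for i
    proof -
      have "h * real i \<le> h * real k"
        using that h by (intro mult_left_mono) auto
      then show ?thesis
        using hk by (simp add: x_def)
    qed
    have xk: "x (Suc k) = t"
      using hk by (simp add: x_def algebra_simps)
    have lim: "\<bar>(\<Sum>i<Suc k. (x (Suc i) - x i) * f (x (Suc i))) - I\<bar> < e / 2"
    proof (rule D)
      show "mono x"
        using h unfolding mono_def x_def by (intro allI impI min.mono mult_left_mono) auto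
      show "x (Suc i) - x i < d" for i
        using h d by (simp add: x_def min_def algebra_simps split: if_splits)
    qed (use xk assms(2) in \<open>auto simp: x_def\<close>)
    have split: "(\<Sum>i<Suc k. (x (Suc i) - x i) * f (x (Suc i)))
        = (\<Sum>i<k. h * f (h * real (Suc i))) + (t - h * real k) * f t"
    proof -
      have "(\<Sum>i<k. (x (Suc i) - x i) * f (x (Suc i))) = (\<Sum>i<k. h * f (h * real (Suc i)))"
        by (intro sum.cong refl) (simp add: xle algebra_simps)
      then show ?thesis
        by (simp add: xk xle)
    qed
    define u where "u = (t - h * real k) * f t"
    have "u \<le> (t - h * real k) * 1"
      using hk assms(3) unfolding u_def by (intro mult_left_mono) auto
    also have "\<dots> < e / 2"
      using h hk by (simp add: algebra_simps)
    finally have "u < e / 2" .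
    moreover note lim[unfolded split, folded u_def]
    moreover have "(\<Sum>i<k. h * f (h * real (Suc i))) = h * (\<Sum>i=1..k. f (h * real i))"
      by (simp only: One_nat_def sum.atLeast1_atMost_eq sum_distrib_left)
    ultimately show "I - e \<le> h * (\<Sum>i=1..nat \<lfloor>t / h\<rfloor>. f (h * real i))"
      unfolding k_def[symmetric] by linarith
  qed
qed

section \<open>Concentration of the counts\<close>

lemma (in prob_space) Hoeffding_unit_interval:
  fixes X :: "nat \<Rightarrow> 'a \<Rightarrow> real"
  assumes "indep_vars (\<lambda>_. borel) X {1..k}"
    and "\<And>i \<omega>. i \<in> {1..k} \<Longrightarrow> \<omega> \<in> space M \<Longrightarrow> X i \<omega> \<in> {0..1}"
    and "k \<ge> 1" "\<eta> \<ge> 0"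
  shows "prob {\<omega>\<in>space M. (\<Sum>i=1..k. X i \<omega>) \<le> (\<Sum>i=1..k. expectation (X i)) - \<eta> * real k}
           \<le> exp (- 2 * \<eta>\<^sup>2 * real k)"
proof -
  interpret Hoeffding_ineq M "{1..k}" X "\<lambda>_. 0" "\<lambda>_. 1" "\<Sum>i=1..k. expectation (X i)"
    using assms by unfold_locales auto
  have "- 2 * (\<eta> * real k)\<^sup>2 / (\<Sum>i=1..k. (1 - 0)\<^sup>2) = - 2 * \<eta>\<^sup>2 * real k"
    using assms(3) by (simp add: power2_eq_square)
  then show ?thesis
    using Hoeffding_ineq_le[of "\<eta> * real k"] assms(3,4) by simp
qed

lemma vct_model_measurable:
  assumes "vct_model \<pi> \<beta> F0 F1 m M p H" "k \<in> {1..m}"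
  shows "p k \<in> borel_measurable M" "H k \<in> measurable M (count_space UNIV)"
proof -
  interpret prob_space M
    using assms by (simp add: vct_model_def)
  have "(\<lambda>\<omega>. (p k \<omega>, H k \<omega>)) \<in> M \<rightarrow>\<^sub>M borel \<Otimes>\<^sub>M count_space UNIV"
    using assms unfolding vct_model_def indep_vars_def by blast
  from measurable_compose[OF this measurable_fst] measurable_compose[OF this measurable_snd]
  show "p k \<in> borel_measurable M" "H k \<in> measurable M (count_space UNIV)"
    by simp_all
qed

text \<open>Total probability over the value of \<open>H k\<close>, arranged so that the signal
  probability enters linearly.\<close>

lemma vct_model_marginal:
  assumes par: "vct_params \<pi> \<beta> F0 F1" and mod: "vct_model \<pi> \<beta> F0 F1 m M p H"
    and k: "k \<in> {1..m}" and t: "t \<in> {0..1}"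
  shows "\<P>(\<omega> in M. p k \<omega> \<le> t) =
    F0 t + \<pi> (real m powr \<beta> * real k / real m) * (F1 t - F0 t)"
proof -
  interpret prob_space M
    using mod by (simp add: vct_model_def)
  note [measurable] = vct_model_measurable[OF mod k]
  define x where "x = \<pi> (real m powr \<beta> * real k / real m)"
  have x: "0 \<le> x" "x < 1"
    using par by (auto simp: vct_params_def x_def)
  have H: "H k \<omega> \<in> {0, 1}" if "\<omega> \<in> space M" for \<omega>
    using mod k that unfolding vct_model_def by blast
  have P1: "\<P>(\<omega> in M. H k \<omega> = 1) = x"
    using mod k unfolding vct_model_def x_def by blast
  have "\<P>(\<omega> in M. H k \<omega> = 0) = \<P>(\<omega> in M. \<not> H k \<omega> = 1)"
    using H by (intro arg_cong[where f = prob]) auto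
  also have "\<dots> = 1 - x"
    unfolding P1[symmetric] by (rule prob_neg) measurable
  finally have P0: "\<P>(\<omega> in M. H k \<omega> = 0) = 1 - x" .
  \<comment> \<open>As \<open>x < 1\<close>, a true null has positive probability, so its
    conditional law is constrained.\<close>
  have "\<P>(\<omega> in M. p k \<omega> \<le> t \<bar> H k \<omega> = 0) = F0 t"
    using mod k t P0 x unfolding vct_model_def by auto
  then have J0: "\<P>(\<omega> in M. p k \<omega> \<le> t \<and> H k \<omega> = 0) = (1 - x) * F0 t"
    using x by (simp add: cond_prob_def P0 field_simps)
  have J1: "\<P>(\<omega> in M. p k \<omega> \<le> t \<and> H k \<omega> = 1) = x * F1 t"
  \<comment> \<open>If \<open>x = 0\<close>, the model says nothing about the conditional law, but
    the joint event is null.\<close>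
  proof (cases "x = 0")
    case True
    have "\<P>(\<omega> in M. p k \<omega> \<le> t \<and> H k \<omega> = 1) \<le> \<P>(\<omega> in M. H k \<omega> = 1)"
      by (rule finite_measure_mono) auto
    then show ?thesis
      using True P1 measure_nonneg[of M] by (auto intro: antisym)
  next
    case False
    then have "\<P>(\<omega> in M. p k \<omega> \<le> t \<bar> H k \<omega> = 1) = F1 t"
      using mod k t P1 x unfolding vct_model_def by auto
    then show ?thesis
      unfolding cond_prob_def P1 using False by (simp add: field_simps)
  qed
  have "\<P>(\<omega> in M. p k \<omega> \<le> t) =
      prob ({\<omega>\<in>space M. p k \<omega> \<le> t \<and> H k \<omega> = 0} \<union> {\<omega>\<in>space M. p k \<omega> \<le> t \<and> H k \<omega> = 1})"
    using H by (intro arg_cong[where f = prob]) auto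
  also have "\<dots> = (1 - x) * F0 t + x * F1 t"
    unfolding J0[symmetric] J1[symmetric] by (rule finite_measure_Union) auto
  finally show ?thesis
    by (simp add: x_def algebra_simps)
qed

lemma vct_model_indep:
  assumes "vct_model \<pi> \<beta> F0 F1 m M p H" "k \<le> m" and [measurable]: "A \<in> sets borel"
  shows "prob_space.indep_vars M (\<lambda>_. borel) (\<lambda>i \<omega>. indicat_real A (p i \<omega>)) {1..k}"
proof -
  interpret prob_space M
    using assms(1) by (simp add: vct_model_def)
  have "indep_vars (\<lambda>_. borel \<Otimes>\<^sub>M count_space UNIV) (\<lambda>k \<omega>. (p k \<omega>, H k \<omega>)) {1..m}"
    using assms(1) unfolding vct_model_def by blast
  moreover have "{1..k} \<subseteq> {1..m}"
    using assms(2) by auto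
  ultimately have "indep_vars (\<lambda>_. borel \<Otimes>\<^sub>M count_space UNIV) (\<lambda>k \<omega>. (p k \<omega>, H k \<omega>)) {1..k}"
    by (rule indep_vars_subset)
  then have "indep_vars (\<lambda>_. borel) (\<lambda>i \<omega>. indicat_real A (fst (p i \<omega>, H i \<omega>))) {1..k}"
    by (rule indep_vars_compose2) measurable
  then show ?thesis
    by simp
qed

lemma real_n_le: "real (n_le s q k) = (\<Sum>i=1..k. indicat_real {..s} (q i))"
  unfolding n_le_def of_nat_sum by (intro sum.cong) (simp_all add: indicator_def)

text \<open>Since \<open>F1 s \<ge> s\<close>, a lower bound on the average signal probability gives
  a lower bound on the expected count; hence \<open>E\<close> lies in the lower tail event of
  Hoeffding's inequality.\<close>

lemma vct_model_n_le_concentration: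
  assumes par: "vct_params \<pi> \<beta> F0 F1" and mod: "vct_model \<pi> \<beta> F0 F1 m M p H"
    and k: "1 \<le> k" "k \<le> m" and s: "s \<in> {0..1}" "F0 s = s" "F1 s \<ge> s" and \<eta>: "\<eta> \<ge> 0"
    and x: "x * real k \<le> (\<Sum>i=1..k. \<pi> (real m powr \<beta> * real i / real m))"
  defines "E \<equiv> {\<omega>\<in>space M. real (n_le s (\<lambda>i. p i \<omega>) k) \<le> (s + x * (F1 s - s) - \<eta>) * real k}"
  shows "E \<in> sets M" "measure M E \<le> exp (- 2 * \<eta>\<^sup>2 * real k)"
proof -
  interpret prob_space M
    using mod by (simp add: vct_model_def)
  have p[measurable]: "p i \<in> borel_measurable M" if "i \<in> {1..k}" for i
    using vct_model_measurable(1)[OF mod, of i] that k by auto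
  show "E \<in> sets M"
    unfolding E_def real_n_le by measurable
  let ?X = "\<lambda>i \<omega>. indicat_real {..s} (p i \<omega>)"
  have "expectation (?X i) = s + \<pi> (real m powr \<beta> * real i / real m) * (F1 s - s)"
    if "i \<in> {1..k}" for i
  proof -
    have [measurable]: "p i \<in> borel_measurable M"
      using p that .
    have "expectation (?X i) = expectation (indicator {\<omega>\<in>space M. p i \<omega> \<le> s})"
      by (intro Bochner_Integration.integral_cong) (auto simp: indicator_def)
    also have "\<dots> = \<P>(\<omega> in M. p i \<omega> \<le> s)"
      by simp
    finally show ?thesis
      using vct_model_marginal[OF par mod, of i s] that k s by simp
  qed
  then have "(\<Sum>i=1..k. expectation (?X i))
      = s * real k + (\<Sum>i=1..k. \<pi> (real m powr \<beta> * real i / real m)) * (F1 s - s)"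
    by (simp add: sum.distrib sum_distrib_right)
  moreover have "x * real k * (F1 s - s)
      \<le> (\<Sum>i=1..k. \<pi> (real m powr \<beta> * real i / real m)) * (F1 s - s)"
    using x s by (intro mult_right_mono) auto
  ultimately have "E \<subseteq> {\<omega>\<in>space M. (\<Sum>i=1..k. ?X i \<omega>) \<le> (\<Sum>i=1..k. expectation (?X i)) - \<eta> * k}"
    by (auto simp: E_def real_n_le algebra_simps)
  then have "prob E \<le> prob {\<omega>\<in>space M. (\<Sum>i=1..k. ?X i \<omega>) \<le> (\<Sum>i=1..k. expectation (?X i)) - \<eta> * k}"
    by (rule finite_measure_mono) measurable
  also have "\<dots> \<le> exp (- 2 * \<eta>\<^sup>2 * real k)"
    using k \<eta> vct_model_indep[OF mod k(2), of "{..s}"]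
    by (intro Hoeffding_unit_interval) (auto simp: indicator_def)
  finally show "prob E \<le> exp (- 2 * \<eta>\<^sup>2 * real k)" .
qed

text \<open>By complementation \<open>E\<close> is the lower tail event of \<open>n_le\<close> at
  the same threshold. The threshold \<open>s\<close> is generic here and becomes \<open>lam\<close>
  later.\<close>

lemma vct_model_n_gt_concentration:
  assumes par: "vct_params \<pi> \<beta> F0 F1" and mod: "vct_model \<pi> \<beta> F0 F1 m M p H"
    and k: "1 \<le> k" "k \<le> m" and s: "s \<in> {0..1}" "F0 s = s" "F1 s \<ge> s" and \<eta>: "\<eta> \<ge> 0"
    and x: "x * real k \<le> (\<Sum>i=1..k. \<pi> (real m powr \<beta> * real i / real m))"
  defines "E \<equiv> {\<omega>\<in>space M. real (n_gt s (\<lambda>i. p i \<omega>) k) \<ge> (1 - s - x * (F1 s - s) + \<eta>) * real k}"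
  shows "E \<in> sets M" "measure M E \<le> exp (- 2 * \<eta>\<^sup>2 * real k)"
proof -
  have "real (n_gt s q k) \<ge> (1 - s - x * (F1 s - s) + \<eta>) * real k \<longleftrightarrow>
      real (n_le s q k) \<le> (s + x * (F1 s - s) - \<eta>) * real k" for q
  proof -
    have "real (n_gt s q k) = real k - real (n_le s q k)"
      using n_le_add_n_gt[of s q k] by linarith
    then show ?thesis
      by (simp only:) (simp add: algebra_simps)
  qed
  then have "E = {\<omega>\<in>space M. real (n_le s (\<lambda>i. p i \<omega>) k) \<le> (s + x * (F1 s - s) - \<eta>) * real k}"
    unfolding E_def by simp
  then show "E \<in> sets M" "measure M E \<le> exp (- 2 * \<eta>\<^sup>2 * real k)"
    using vct_model_n_le_concentration[OF assms(1-9)] by simp_all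
qed

section \<open>Consistency\<close>

lemma FDP_hat_le_iff:
  assumes "n_le s q k \<noteq> 0"
  shows "FDP_hat s lam q k \<le> \<alpha> \<longleftrightarrow>
    s / (1 - lam) * (1 + real (n_gt lam q k)) \<le> \<alpha> * real (n_le s q k)"
proof -
  have "real (n_le s q k) > 0" "max 1 (real (n_le s q k)) = real (n_le s q k)"
    using assms by auto
  then show ?thesis
    unfolding FDP_hat_def by (simp only: times_divide_eq_right pos_divide_le_eq)
qed

text \<open>The quantity m^\<beta> / m is the spacing of the points at which the model evaluates
  \<pi>. The lower bound on it ensures that at most \<open>m\<close> of them lie in (0, t] for t at
  most 1; its inverse gives their order of growth.\<close>

lemma vct_grid_scale:
  assumes "m \<ge> 1" "0 \<le> \<beta>"
  shows "1 / real m \<le> real m powr \<beta> / real m"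
    and "1 / (real m powr \<beta> / real m) = real m powr (1 - \<beta>)"
proof -
  show "1 / real m \<le> real m powr \<beta> / real m"
    using assms by (intro divide_right_mono ge_one_powr_ge_zero) auto
  show "1 / (real m powr \<beta> / real m) = real m powr (1 - \<beta>)"
    using assms by (simp add: powr_diff)
qed

text \<open>The probabilistic core. The exceptional events are returned as measurable sets, so that
  the later arguments are pathwise and need no measurability of the envelopes.\<close>

lemma vct_r_hat_large:
  fixes M :: "nat \<Rightarrow> 'a measure"
  assumes \<alpha>: "0 < \<alpha>" and s: "0 < s" "s \<le> 1" and lam: "0 \<le> lam" "lam < 1"
    and par: "vct_params \<pi> \<beta> F0 F1"
    and mod: "\<And>m. m \<ge> 1 \<Longrightarrow> vct_model \<pi> \<beta> F0 F1 m (M m) (p m) (H m)"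
    and mean: "running_mean \<pi> PI" and cont: "continuous_on {0..} PI"
    and F: "F0 s = s" "F0 lam = lam" "F1 s > s" "F1 lam > lam"
    and level: "\<alpha> > (1 + \<pi> 0 * ((1 - F1 lam) / (1 - lam) - 1)) / (1 + \<pi> 0 * (F1 s / s - 1))"
  obtains c E where "c > 0" "(\<lambda>m. measure (M m) (E m)) \<longlonglongrightarrow> 0"
    and "eventually (\<lambda>m. E m \<in> sets (M m) \<and>
           (\<forall>\<omega>\<in>space (M m) - E m.
              real (r_hat s lam \<alpha> m (\<lambda>i. p m i \<omega>)) \<ge> c * real m powr (1 - \<beta>))) sequentially"
proof -
  define B where "B = s / (1 - lam)"
  \<comment> \<open>With signal fraction \<open>x\<close>, \<open>\<phi> x\<close> is the expected
    value of \<open>\<alpha> * n_le - B * n_gt\<close> per hypothesis, so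
    \<open>\<phi> x > 0\<close> means that the asymptotic estimate is below \<alpha>. It is affine
    with slope \<open>\<sigma>\<close>.\<close>
  define \<phi> where "\<phi> = (\<lambda>x. \<alpha> * (s + x * (F1 s - s)) - B * (1 - lam - x * (F1 lam - lam)))"
  define \<sigma> where "\<sigma> = \<alpha> * (F1 s - s) + B * (F1 lam - lam)"
  have B: "B > 0" and \<pi>0: "0 < \<pi> 0" and \<beta>: "0 \<le> \<beta>" "\<beta> < 1"
    and \<pi>_le: "\<And>x. x \<ge> 0 \<Longrightarrow> \<pi> x \<le> 1"
    using s lam par by (auto simp: B_def vct_params_def less_imp_le)
  have \<sigma>: "\<sigma> > 0"
    using \<alpha> B F by (auto simp: \<sigma>_def intro!: add_pos_pos)
  \<comment> \<open>This is the level condition multiplied by its positive denominator and by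
    \<open>s\<close>.\<close>
  have \<phi>0: "\<phi> (\<pi> 0) > 0"
  proof -
    have "0 < 1 + \<pi> 0 * (F1 s / s - 1)"
      using \<pi>0 F s by (intro add_pos_pos mult_pos_pos) (auto simp: field_simps)
    with level have "(1 + \<pi> 0 * ((1 - F1 lam) / (1 - lam) - 1)) < \<alpha> * (1 + \<pi> 0 * (F1 s / s - 1))"
      by (simp add: pos_divide_less_eq)
    then have "s * (1 + \<pi> 0 * ((1 - F1 lam) / (1 - lam) - 1)) < s * (\<alpha> * (1 + \<pi> 0 * (F1 s / s - 1)))"
      using s by simp
    moreover have "s * (1 + \<pi> 0 * ((1 - F1 lam) / (1 - lam) - 1)) = B * (1 - lam - \<pi> 0 * (F1 lam - lam))"
      using lam by (simp add: B_def divide_simps) (simp add: algebra_simps)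
    moreover have "s * (\<alpha> * (1 + \<pi> 0 * (F1 s / s - 1))) = \<alpha> * (s + \<pi> 0 * (F1 s - s))"
      using s by (simp add: field_simps)
    ultimately show ?thesis
      by (simp add: \<phi>_def)
  qed
  \<comment> \<open>The decrease costs at most half of \<open>\<phi> (\<pi> 0)\<close>; the minimum
    keeps \<open>x\<close> nonnegative.\<close>
  define x where "x = \<pi> 0 - min (\<pi> 0) (\<phi> (\<pi> 0) / (2 * \<sigma>))"
  have x: "0 \<le> x" "x < \<pi> 0"
    using \<pi>0 \<phi>0 \<sigma> by (auto simp: x_def)
  have \<phi>x: "\<phi> x > 0"
  proof -
    have "\<sigma> * (\<pi> 0 - x) \<le> \<sigma> * (\<phi> (\<pi> 0) / (2 * \<sigma>))"
      using \<sigma> by (intro mult_left_mono) (auto simp: x_def)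
    moreover have "\<phi> x = \<phi> (\<pi> 0) - \<sigma> * (\<pi> 0 - x)"
      by (simp add: \<phi>_def \<sigma>_def algebra_simps)
    ultimately show ?thesis
      using \<phi>0 \<sigma> by simp
  qed
  \<comment> \<open>Continuity of \<open>PI\<close> at 0 provides \<open>t\<close>; the bound
    \<open>t \<le> 1\<close> will give \<open>k m \<le> m\<close>.\<close>
  obtain t where t: "0 < t" "t \<le> 1" "x < PI t"
  proof -
    have "PI 0 = \<pi> 0"
      using mean by (simp add: running_mean_def)
    moreover have "0 < PI 0 - x"
      using x calculation by simp
    then obtain d where "d > 0" "\<And>u. u \<ge> 0 \<Longrightarrow> dist u 0 < d \<Longrightarrow> dist (PI u) (PI 0) < PI 0 - x"
      using cont[unfolded continuous_on_iff, rule_format, of 0 "PI 0 - x"] by auto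
    from this(1) this(2)[of "min 1 (d / 2)"] show ?thesis
      by (intro that[of "min 1 (d / 2)"]) (auto simp: dist_real_def min_def split: if_splits)
  qed
  obtain I where I: "has_riemann_integral \<pi> I 0 t" "I = t * PI t"
    using mean t by (force simp: running_mean_def)
  \<comment> \<open>This slack is the error allowed in the Riemann sum, so the sum stays above
    \<open>x * t\<close>.\<close>
  have "I - x * t > 0"
    using t I(2) by (simp add: algebra_simps)
  then obtain d where d: "d > 0"
    and grid: "\<And>h. 0 < h \<Longrightarrow> h < d \<Longrightarrow> x * t \<le> h * (\<Sum>i=1..nat \<lfloor>t / h\<rfloor>. \<pi> (h * real i))"
    using riemann_integral_le_grid_sum[OF I(1) t(1) \<pi>_le, of "I - x * t"] t by auto
  define h where "h = (\<lambda>m. real m powr \<beta> / real m)"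
  define k where "k = (\<lambda>m. nat \<lfloor>t / h m\<rfloor>)"
  \<comment> \<open>The first bound keeps \<open>n_le\<close> above \<open>s / 2\<close> per
    hypothesis; the second lets the two deviations together use up at most half of
    \<open>\<phi> x\<close>.\<close>
  define \<eta> where "\<eta> = min (s / 2) (\<phi> x / (2 * (B + \<alpha>)))"
  have \<eta>: "0 < \<eta>" "\<eta> \<le> s / 2" "(B + \<alpha>) * \<eta> \<le> \<phi> x / 2"
  proof -
    show "0 < \<eta>" "\<eta> \<le> s / 2"
      unfolding \<eta>_def using s \<phi>x B \<alpha> by (simp, intro min.cobounded1)
    have "(B + \<alpha>) * \<eta> \<le> (B + \<alpha>) * (\<phi> x / (2 * (B + \<alpha>)))"
      using B \<alpha> by (intro mult_left_mono) (auto simp: \<eta>_def)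
    also have "\<dots> = \<phi> x / 2"
      using B \<alpha> by (simp add: field_simps)
    finally show "(B + \<alpha>) * \<eta> \<le> \<phi> x / 2" .
  qed
  define E1 where "E1 = (\<lambda>m. {\<omega>\<in>space (M m).
    real (n_le s (\<lambda>i. p m i \<omega>) (k m)) \<le> (s + x * (F1 s - s) - \<eta>) * real (k m)})"
  define E2 where "E2 = (\<lambda>m. {\<omega>\<in>space (M m).
    real (n_gt lam (\<lambda>i. p m i \<omega>) (k m)) \<ge> (1 - lam - x * (F1 lam - lam) + \<eta>) * real (k m)})"
  have "h \<longlonglongrightarrow> 0"
    unfolding h_def using \<beta> by real_asymp
  then have ev_h: "eventually (\<lambda>m. h m < d) sequentially"
    using d by (rule order_tendstoD)
  have t_h: "t / h m = t * real m powr (1 - \<beta>)" if "m \<ge> 1" for m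
    using vct_grid_scale(2)[OF that \<beta>(1)] unfolding h_def by (metis mult.right_neutral times_divide_eq_right)
  have "filterlim (\<lambda>m. t * real m powr (1 - \<beta>)) at_top sequentially"
    using t \<beta> by real_asymp
  \<comment> \<open>The 2 absorbs the rounding in \<open>k m\<close>; the other threshold makes
    \<open>\<phi> x / 2 * k m\<close> at least \<open>B\<close>, which pays for the added 1 in
    \<open>FDP_hat\<close>.\<close>
  then have ev_large: "eventually (\<lambda>m. max 2 (4 * B / \<phi> x) \<le> t * real m powr (1 - \<beta>)) sequentially"
    unfolding filterlim_at_top by blast
  have ev: "eventually (\<lambda>m. m \<ge> 1 \<and> h m < d \<and> max 2 (4 * B / \<phi> x) \<le> t / h m) sequentially"
    using ev_h ev_large eventually_ge_at_top[of 1] by eventually_elim (simp add: t_h)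
  have k_bounds: "1 \<le> k m" "k m \<le> m" "t / h m / 2 \<le> real (k m)" "h m * real (k m) \<le> t"
    "0 < h m" "2 * B \<le> \<phi> x * real (k m)"
    if m: "m \<ge> 1" "max 2 (4 * B / \<phi> x) \<le> t / h m" for m
  proof -
    show h: "0 < h m"
      using m by (auto simp: h_def)
    have fl: "real (k m) \<le> t / h m" "t / h m - 1 < real (k m)"
      using t h by (auto simp: k_def)
    define u where "u = t / h m"
    have u: "2 \<le> u" "4 * B / \<phi> x \<le> u" "u - 1 < real (k m)"
      using m fl by (simp_all add: u_def)
    show half: "t / h m / 2 \<le> real (k m)"
      unfolding u_def[symmetric] using u by linarith
    show "1 \<le> k m"
      using u by linarith
    have "4 * B \<le> u * \<phi> x"
      using u(2) \<phi>x by (simp add: pos_divide_le_eq)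
    also have "\<dots> \<le> 2 * real (k m) * \<phi> x"
      using half \<phi>x unfolding u_def[symmetric] by (intro mult_right_mono) auto
    finally show "2 * B \<le> \<phi> x * real (k m)"
      by (simp add: mult_ac)
    show "h m * real (k m) \<le> t"
      using fl h by (simp add: field_simps)
    have "1 / real m \<le> h m"
      unfolding h_def by (rule vct_grid_scale(1)[OF m(1) \<beta>(1)])
    then have "t / h m \<le> 1 / (1 / real m)"
      using t h m(1) by (intro frac_le) auto
    then show "k m \<le> m"
      using fl by simp
  qed
  have signal: "x * real (k m) \<le> (\<Sum>i=1..k m. \<pi> (real m powr \<beta> * real i / real m))"
    if m: "m \<ge> 1" "h m < d" "max 2 (4 * B / \<phi> x) \<le> t / h m" for m
  proof -
    note kb = k_bounds[OF m(1,3)]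
    have "h m * (x * real (k m)) = x * (h m * real (k m))"
      by simp
    also have "\<dots> \<le> x * t"
      using kb x by (intro mult_left_mono) auto
    also have "\<dots> \<le> h m * (\<Sum>i=1..k m. \<pi> (h m * real i))"
      unfolding k_def using m kb by (intro grid) auto
    finally have "x * real (k m) \<le> (\<Sum>i=1..k m. \<pi> (h m * real i))"
      using kb(5) by (simp only: mult_le_cancel_left_pos)
    then show ?thesis
      by (simp add: h_def)
  qed
  have E: "E1 m \<in> sets (M m)" "E2 m \<in> sets (M m)"
    "measure (M m) (E1 m \<union> E2 m) \<le> 2 * exp (- \<eta>\<^sup>2 * t * real m powr (1 - \<beta>))"
    if m: "m \<ge> 1" "h m < d" "max 2 (4 * B / \<phi> x) \<le> t / h m" for m
  proof -
    note kb = k_bounds[OF m(1,3)]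
    have c1: "E1 m \<in> sets (M m)" "measure (M m) (E1 m) \<le> exp (- 2 * \<eta>\<^sup>2 * real (k m))"
      unfolding E1_def using kb s F \<eta> signal[OF m]
      by (intro vct_model_n_le_concentration[OF par mod]; simp add: m)+
    have c2: "E2 m \<in> sets (M m)" "measure (M m) (E2 m) \<le> exp (- 2 * \<eta>\<^sup>2 * real (k m))"
      unfolding E2_def using kb lam F \<eta> signal[OF m]
      by (intro vct_model_n_gt_concentration[OF par mod]; simp add: m)+
    show "E1 m \<in> sets (M m)" "E2 m \<in> sets (M m)"
      by fact+
    have "measure (M m) (E1 m \<union> E2 m) \<le> 2 * exp (- 2 * \<eta>\<^sup>2 * real (k m))"
      using measure_Un_le[OF c1(1) c2(1)] c1(2) c2(2) by linarith
    also have "\<dots> \<le> 2 * exp (- \<eta>\<^sup>2 * t * real m powr (1 - \<beta>))"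
    proof -
      have "\<eta>\<^sup>2 * (t / h m) \<le> \<eta>\<^sup>2 * (2 * real (k m))"
        using kb by (intro mult_left_mono) auto
      then show ?thesis
        using m by (simp add: t_h mult_ac)
    qed
    finally show "measure (M m) (E1 m \<union> E2 m) \<le> 2 * exp (- \<eta>\<^sup>2 * t * real m powr (1 - \<beta>))" .
  qed
  have reject: "s * t / 4 * real m powr (1 - \<beta>) \<le> real (r_hat s lam \<alpha> m (\<lambda>i. p m i \<omega>))"
    if m: "m \<ge> 1" "h m < d" "max 2 (4 * B / \<phi> x) \<le> t / h m"
      and \<omega>: "\<omega> \<in> space (M m) - (E1 m \<union> E2 m)" for m \<omega>
  proof -
    note kb = k_bounds[OF m(1,3)]
    define q where "q = (\<lambda>i. p m i \<omega>)"
    have le: "(s + x * (F1 s - s) - \<eta>) * real (k m) < real (n_le s q (k m))"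
      and gt: "real (n_gt lam q (k m)) < (1 - lam - x * (F1 lam - lam) + \<eta>) * real (k m)"
      using \<omega> by (auto simp: E1_def E2_def q_def)
    have "s / 2 * real (k m) \<le> (s + x * (F1 s - s) - \<eta>) * real (k m)"
    proof (intro mult_right_mono)
      have "0 \<le> x * (F1 s - s)"
        using x F by simp
      then show "s / 2 \<le> s + x * (F1 s - s) - \<eta>"
        using \<eta>(2) by linarith
    qed simp
    also note le
    finally have n_le: "s / 2 * real (k m) < real (n_le s q (k m))" .
    moreover have "0 < s / 2 * real (k m)"
      using s kb(1) by simp
    ultimately have "n_le s q (k m) \<noteq> 0"
      by linarith
    have "B * (1 + real (n_gt lam q (k m)))
        \<le> B * (1 + (1 - lam - x * (F1 lam - lam) + \<eta>) * real (k m))"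
      using gt B by (intro mult_left_mono) auto
    \<comment> \<open>The identity isolates the lower bound for \<open>n_le\<close>; the subtracted
      reserve is at least \<open>\<phi> x / 2\<close> per hypothesis and outweighs
      \<open>B\<close>.\<close>
    also have "\<dots> = B + \<alpha> * ((s + x * (F1 s - s) - \<eta>) * real (k m))
        - (\<phi> x - (B + \<alpha>) * \<eta>) * real (k m)"
      by (simp add: \<phi>_def algebra_simps)
    also have "\<dots> \<le> B + \<alpha> * real (n_le s q (k m)) - \<phi> x / 2 * real (k m)"
      using le \<eta>(3) \<alpha> by (intro diff_mono add_left_mono mult_left_mono mult_right_mono) auto
    also have "\<dots> \<le> \<alpha> * real (n_le s q (k m))"
      using kb by simp
    finally have "FDP_hat s lam q (k m) \<le> \<alpha>"
      using FDP_hat_le_iff[OF \<open>n_le s q (k m) \<noteq> 0\<close>] by (simp add: B_def)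
    then have "n_le s q (k m) \<le> r_hat s lam \<alpha> m q"
      unfolding r_hat_def using kb by (intro n_le_mono k_hat_ge) auto
    \<comment> \<open>The constant \<open>s * t / 4\<close> is the product of \<open>s / 2\<close>
      from the count and \<open>t / 2\<close> from the rounding in \<open>k m\<close>.\<close>
    moreover have "s / 2 * (t / h m / 2) \<le> s / 2 * real (k m)"
      using s kb by (intro mult_left_mono) auto
    ultimately show ?thesis
      using n_le m by (simp add: t_h q_def mult_ac)
  qed
  show ?thesis
  proof (rule that[of "s * t / 4" "\<lambda>m. E1 m \<union> E2 m"])
    show "s * t / 4 > 0"
      using s t by simp
    define a where "a = \<eta>\<^sup>2 * t"
    have "a > 0"
      using \<eta> t by (simp add: a_def)
    then have lim: "(\<lambda>m. 2 * exp (- a * real m powr (1 - \<beta>))) \<longlonglongrightarrow> 0"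
      using \<beta> by real_asymp
    show "(\<lambda>m. measure (M m) (E1 m \<union> E2 m)) \<longlonglongrightarrow> 0"
    proof (rule tendsto_sandwich[OF _ _ tendsto_const lim])
      show "eventually (\<lambda>m. measure (M m) (E1 m \<union> E2 m) \<le> 2 * exp (- a * real m powr (1 - \<beta>))) sequentially"
        using ev by eventually_elim (use E(3) in \<open>simp add: a_def\<close>)
    qed simp
    show "eventually (\<lambda>m. E1 m \<union> E2 m \<in> sets (M m) \<and>
           (\<forall>\<omega>\<in>space (M m) - (E1 m \<union> E2 m).
              real (r_hat s lam \<alpha> m (\<lambda>i. p m i \<omega>)) \<ge> s * t / 4 * real m powr (1 - \<beta>))) sequentially"
      using ev by eventually_elim (use E(1,2) reject in blast)
  qed
qed

section \<open>From many rejections to consistency\<close>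

text \<open>Separates chance from determinism: \<open>P\<close> holds off the small event
  \<open>E m\<close>, and \<open>P\<close> alone forces \<open>T\<close> below \<alpha> + \<epsilon>
  for large \<open>m\<close>, so every violation lies in \<open>E m\<close>.\<close>

lemma consistentI:
  fixes M :: "nat \<Rightarrow> 'a measure"
  assumes "\<And>m. m \<ge> 1 \<Longrightarrow> prob_space (M m)"
    and "(\<lambda>m. measure (M m) (E m)) \<longlonglongrightarrow> 0"
    and "eventually (\<lambda>m. E m \<in> sets (M m) \<and>
           (\<forall>\<omega>\<in>space (M m) - E m. P m (\<lambda>i. p m i \<omega>))) sequentially"
    and "\<And>\<epsilon>. \<epsilon> > 0 \<Longrightarrow> eventually (\<lambda>m. \<forall>q. P m q \<longrightarrow> T m q < \<alpha> + \<epsilon>) sequentially"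
  shows "consistent M p \<alpha> T"
  unfolding consistent_def
proof (intro allI impI)
  fix \<epsilon> :: real
  assume "\<epsilon> > 0"
  show "(\<lambda>m. \<P>(\<omega> in M m. \<epsilon> \<le> T m (\<lambda>i. p m i \<omega>) - \<alpha>)) \<longlonglongrightarrow> 0"
  proof (rule tendsto_sandwich[OF _ _ tendsto_const assms(2)])
    show "eventually (\<lambda>m. \<P>(\<omega> in M m. \<epsilon> \<le> T m (\<lambda>i. p m i \<omega>) - \<alpha>) \<le> measure (M m) (E m)) sequentially"
      using assms(3) assms(4)[OF \<open>\<epsilon> > 0\<close>] eventually_ge_at_top[of 1]
    proof eventually_elim
      case (elim m)
      interpret prob_space "M m"
        using elim by (intro assms(1))
      have "{\<omega>\<in>space (M m). \<epsilon> \<le> T m (\<lambda>i. p m i \<omega>) - \<alpha>} \<subseteq> E m"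
        using elim by fastforce
      then show ?case
        using elim by (intro finite_measure_mono) auto
    qed
  qed simp
qed

theorem corollary24:
  fixes \<alpha> \<delta> s lam \<beta> L :: real
    and \<pi> PI F0 F1 :: "real \<Rightarrow> real"
    and M :: "nat \<Rightarrow> 'a measure"
    and p :: "nat \<Rightarrow> nat \<Rightarrow> 'a \<Rightarrow> real"
    and H :: "nat \<Rightarrow> nat \<Rightarrow> 'a \<Rightarrow> nat"
  assumes "0 < \<alpha>" "\<alpha> < 1" "0 < \<delta>" "\<delta> < 1"
    and "0 < s" "s \<le> 1" "0 \<le> lam" "lam < 1" "s \<le> lam"
    and "vct_params \<pi> \<beta> F0 F1"
    and "\<And>m. m \<ge> 1 \<Longrightarrow> vct_model \<pi> \<beta> F0 F1 m (M m) (p m) (H m)"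
    and "running_mean \<pi> PI"
    and "continuous_on {0..} PI" "antimono_on {0..} PI" "L-lipschitz_on {0..} PI"
    and "F0 s = s" "F0 lam = lam" "F1 s > s" "F1 lam > lam"
    and "\<alpha> > (1 + \<pi> 0 * ((1 - F1 lam) / (1 - lam) - 1)) / (1 + \<pi> 0 * (F1 s / s - 1))"
  shows "consistent M p \<alpha> (\<lambda>m q. KRU_env s lam \<delta> q (k_hat s lam \<alpha> m q)) \<and>
         consistent M p \<alpha> (\<lambda>m q. KRU_bound s lam \<delta> \<alpha> (r_hat s lam \<alpha> m q)) \<and>
         (lam = s \<or> \<beta> < 1 / 2 \<longrightarrow>
            consistent M p \<alpha> (\<lambda>m q. Freed_env s lam \<delta> q (k_hat s lam \<alpha> m q)) \<and>
            consistent M p \<alpha>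
              (\<lambda>m q. Freed_bound s lam \<delta> \<alpha> (k_hat s lam \<alpha> m q) (r_hat s lam \<alpha> m q)))"
proof -
  obtain c E where c: "c > 0" and E: "(\<lambda>m. measure (M m) (E m)) \<longlonglongrightarrow> 0"
    "eventually (\<lambda>m. E m \<in> sets (M m) \<and>
           (\<forall>\<omega>\<in>space (M m) - E m.
              real (r_hat s lam \<alpha> m (\<lambda>i. p m i \<omega>)) \<ge> c * real m powr (1 - \<beta>))) sequentially"
    using vct_r_hat_large[OF assms(1,5-8,10-13,16-20)] by blast
  have prob: "prob_space (M m)" if "m \<ge> 1" for m
    using assms(11)[OF that] by (simp add: vct_model_def)
  \<comment> \<open>The same property and the same exceptional events serve all four claims.\<close>
  note consistentI = consistentI[where P = "\<lambda>m q. real (r_hat s lam \<alpha> m q) \<ge> c * real m powr (1 - \<beta>)",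
      OF prob E]
  have \<beta>: "\<beta> < 1"
    using assms(10) by (simp add: vct_params_def)
  have lim: "filterlim (\<lambda>m. c * real m powr (1 - \<beta>)) at_top sequentially"
    using c \<beta> by real_asymp
  have KRU: "eventually (\<lambda>m. \<forall>q. real (r_hat s lam \<alpha> m q) \<ge> c * real m powr (1 - \<beta>) \<longrightarrow>
      KRU_bound s lam \<delta> \<alpha> (r_hat s lam \<alpha> m q) < \<alpha> + \<epsilon>) sequentially" if "\<epsilon> > 0" for \<epsilon>
  proof -
    obtain R where R: "\<And>r. r \<ge> R \<Longrightarrow> KRU_bound s lam \<delta> \<alpha> r < \<alpha> + \<epsilon>"
      using KRU_bound_le_eventually[OF assms(3,4,5,8,1) \<open>\<epsilon> > 0\<close>]
      unfolding eventually_sequentially by blast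
    have "eventually (\<lambda>m. real R \<le> c * real m powr (1 - \<beta>)) sequentially"
      using lim by (simp add: filterlim_at_top)
    then show ?thesis
    proof eventually_elim
      case (elim m)
      then show ?case
        by (intro allI impI R) linarith
    qed
  qed
  have Freed: "eventually (\<lambda>m. \<forall>q. real (r_hat s lam \<alpha> m q) \<ge> c * real m powr (1 - \<beta>) \<longrightarrow>
      Freed_bound s lam \<delta> \<alpha> (k_hat s lam \<alpha> m q) (r_hat s lam \<alpha> m q) < \<alpha> + \<epsilon>) sequentially"
    if "\<epsilon> > 0" "lam = s \<or> \<beta> < 1 / 2" for \<epsilon>
    using assms that c \<beta> by (intro Freed_bound_le_eventually) auto
  have Freed_env: "eventually (\<lambda>m. \<forall>q. real (r_hat s lam \<alpha> m q) \<ge> c * real m powr (1 - \<beta>) \<longrightarrow>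
      Freed_env s lam \<delta> q (k_hat s lam \<alpha> m q) < \<alpha> + \<epsilon>) sequentially"
    if "\<epsilon> > 0" "lam = s \<or> \<beta> < 1 / 2" for \<epsilon>
    using Freed[OF that] eventually_ge_at_top[of 1]
  proof eventually_elim
    case (elim m)
    show ?case
    proof (intro allI impI)
      fix q
      assume r: "c * real m powr (1 - \<beta>) \<le> real (r_hat s lam \<alpha> m q)"
      \<comment> \<open>Positivity, which uses \<open>m \<ge> 1\<close>, excludes
        \<open>r_hat = 0\<close>, so the Freedman envelope is below its bound.\<close>
      moreover have "0 < c * real m powr (1 - \<beta>)"
        using c elim by simp
      ultimately have "r_hat s lam \<alpha> m q \<noteq> 0"
        by linarith
      from Freed_env_le_bound[OF assms(3,4,5,8,1) this]
      show "Freed_env s lam \<delta> q (k_hat s lam \<alpha> m q) < \<alpha> + \<epsilon>"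
        using elim r by (meson le_less_trans)
    qed
  qed
  have KRU_env: "eventually (\<lambda>m. \<forall>q. real (r_hat s lam \<alpha> m q) \<ge> c * real m powr (1 - \<beta>) \<longrightarrow>
      KRU_env s lam \<delta> q (k_hat s lam \<alpha> m q) < \<alpha> + \<epsilon>) sequentially" if "\<epsilon> > 0" for \<epsilon>
    using KRU[OF that]
    by eventually_elim (meson KRU_env_le_bound[OF assms(3,4,5,8,1)] le_less_trans)
  show ?thesis
    by (intro conjI impI consistentI KRU KRU_env Freed Freed_env)
qed

end
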